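(* Let $\mathbf Q\in\mathcal M_d(\mathbb R)$, $\mathbf c\in\mathbb R^d$, $\mathbf d\in\mathbb R$, $\mathbf A\in\mathcal M_{p,d}(\mathbb R)$, $\mathbf b\in\mathbb R^p$ and $\mathbf P=\mathbf C^{-1}\in\mathcal M_p(\mathbb R)$ be the data of the scalable problem defined in the context, let $\mathcal X=[0,1]^d$, let $\kappa\in\mathbb R$, and let $\mathbf U=(\mathbf U_1,\dots,\mathbf U_N)$ be a square-integrable centered random vector in $\mathbb R^p$, with $\mathbf U_1,\dots,\mathbf U_N$ independent and with (block diagonal) covariance matrix $\boldsymbol\Sigma=\mathrm{diag}(\boldsymbol\Sigma_1,\dots,\boldsymbol\Sigma_N)$. Then the robust optimization problem $$\min_{\mathbf x\in\mathcal X}\ \tfrac12\mathbf x^\top\mathbf Q\mathbf x+\mathbf c^\top\mathbf x+\mathbf d+\mathbb E[\mathbf U^\top\mathbf P^\top\mathbf P\mathbf U]\quad\text{s.t.}\quad \mathbb E[\mathbf A\mathbf x-\mathbf b-\mathbf P\mathbf U]+\kappa\,\sigma[\mathbf A\mathbf x-\mathbf b-\mathbf P\mathbf U]\preccurlyeq\mathbf 0$$ reduces to (i.e. has the same objective function and the same feasible set as) the quadratic optimization problem $$\min_{\mathbf x\in\mathcal X}\ \tfrac12\mathbf x^\top\mathbf Q\mathbf x+\mathbf c^\top\mathbf x+\mathbf d+\mathbb E[\mathbf U^\top\mathbf P^\top\mathbf P\mathbf U]\quad\text{s.t.}\quad \mathbf A\mathbf x\preccurlyeq\mathbf b-\kappa\sqrt{\mathrm{diag}(\mathbf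 P\boldsymbol\Sigma\mathbf P^\top)}.$$
   Context: Notation: $\preccurlyeq$ is the component-wise inequality on $\mathbb R^p$; for a square matrix $\mathbf M$, $\mathrm{diag}(\mathbf M)$ is the vector of its diagonal entries; $\sqrt{\cdot}$ applied to a vector is taken entry-wise; for a square-integrable random vector $\mathbf V$, $\sigma[\mathbf V]=\sqrt{\mathrm{diag}(\mathrm{Cov}[\mathbf V])}$ is the vector of component-wise standard deviations. Data of the scalable problem: integers $N,d_0,\dots,d_N,p_1,\dots,p_N\ge1$, $d=\sum_{i=0}^N d_i$, $p=\sum_{i=1}^N p_i$; deterministic vectors $\mathbf a,\mathbf t\in\mathbb R^p$; deterministic blocks $\mathbf D_{i,0}\in\mathcal M_{p_i,d_0}(\mathbb R)$, $\mathbf D_{i,i}\in\mathcal M_{p_i,d_i}(\mathbb R)$, $\mathbf C_{i,j}\in\mathcal M_{p_i,p_j}(\mathbb R)$ ($i\ne j$). The matrix $\mathbf D\in\mathcal M_{p,d}(\mathbb R)$ has first block column $(\mathbf D_{1,0}^\top,\dots,\mathbf D_{N,0}^\top)^\top$, followed by the block-diagonal matrix with blocks $\mathbf D_{1,1},\dots,\mathbf D_{N,N}$; the matrix $\mathbf C\in\mathcal M_p(\mathbb R)$ has identity diagonal blocks (of sizes $p_i$) and off-diagonal blocks $-\mathbf C_{i,j}$, and is assumed invertible. Set $\boldsymbol\alpha=\mathbf C^{-1}\mathbf a$, $\boldsymbol\beta=-\mathbf C^{-1}\mathbf D$, $\mathbf Q_{x_0}=\begin{pmatrix}\mathbf I_{d_0}&\mathbf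 0\\ \mathbf 0&\mathbf 0\end{pmatrix}\in\mathcal M_d(\mathbb R)$, and $$\mathbf Q=2(\mathbf Q_{x_0}+\boldsymbol\beta^\top\boldsymbol\beta),\quad \mathbf c=2\boldsymbol\beta^\top\boldsymbol\alpha,\quad \mathbf d=\boldsymbol\alpha^\top\boldsymbol\alpha,\quad \mathbf A=-\boldsymbol\beta,\quad \mathbf b=\boldsymbol\alpha-\mathbf t.$$ Each $\mathbf U_i$ takes values in $\mathbb R^{p_i}$ and has covariance matrix $\boldsymbol\Sigma_i$. No other assumption is made on the distribution of $\mathbf U$. *)

theory Defs
  imports "HOL-Probability.Probability" "Jordan_Normal_Form.Gauss_Jordan_Elimination"
begin

(* Vectors and matrices are those of Jordan_Normal_Form throughout; the constants and notation of
   HOL-Analysis with the same names are hidden. *)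
hide_type (open) Finite_Cartesian_Product.vec
hide_const (open) Finite_Cartesian_Product.vec Finite_Cartesian_Product.mat
no_notation inner (infix "\<bullet>" 70)
no_notation Finite_Cartesian_Product.vec_nth (infixl "$" 90)

(* [A | B] *)
definition append_cols :: "'a :: zero mat \<Rightarrow> 'a mat \<Rightarrow> 'a mat" (infixr "@\<^sub>c" 65) where
  "A @\<^sub>c B = four_block_mat A B (0\<^sub>m 0 (dim_col A)) (0\<^sub>m 0 (dim_col B))"

(* The numeric argument is the common number of columns (rows) of the blocks; it only matters
   for the empty list. *)
definition vcat_mat :: "nat \<Rightarrow> 'a :: zero mat list \<Rightarrow> 'a mat" where
  "vcat_mat n As = foldr (@\<^sub>r) As (0\<^sub>m 0 n)"

definition hcat_mat :: "nat \<Rightarrow> 'a :: zero mat list \<Rightarrow> 'a mat" where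
  "hcat_mat n As = foldr (@\<^sub>c) As (0\<^sub>m n 0)"

definition vcat_vec :: "'a :: zero vec list \<Rightarrow> 'a vec" where
  "vcat_vec vs = foldr (@\<^sub>v) vs (0\<^sub>v 0)"

definition diag_vec :: "'a mat \<Rightarrow> 'a vec" where
  "diag_vec A = vec_of_list (diag_mat A)"

(* The Borel sigma-algebra of R^n, transported from the product sigma-algebra to vectors. *)
definition borel_vec :: "nat \<Rightarrow> real vec measure" where
  "borel_vec n = vimage_algebra (carrier_vec n) (\<lambda>v. \<lambda>k\<in>{..<n}. v $ k) (\<Pi>\<^sub>M k\<in>{..<n}. borel)"

definition square_integrable_vec :: "'w measure \<Rightarrow> nat \<Rightarrow> ('w \<Rightarrow> real vec) \<Rightarrow> bool" where
  "square_integrable_vec M n V \<longleftrightarrow>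
     V \<in> measurable M (borel_vec n) \<and> (\<forall>k<n. integrable M (\<lambda>\<omega>. (V \<omega> $ k)\<^sup>2))"

definition expectation_vec :: "'w measure \<Rightarrow> nat \<Rightarrow> ('w \<Rightarrow> real vec) \<Rightarrow> real vec" where
  "expectation_vec M n V = vec n (\<lambda>k. \<integral>\<omega>. V \<omega> $ k \<partial>M)"

definition covariance_mat :: "'w measure \<Rightarrow> nat \<Rightarrow> ('w \<Rightarrow> real vec) \<Rightarrow> real mat" where
  "covariance_mat M n V = mat n n (\<lambda>(k, l).
     \<integral>\<omega>. (V \<omega> $ k - expectation_vec M n V $ k) * (V \<omega> $ l - expectation_vec M n V $ l) \<partial>M)"

definition std_dev_vec :: "'w measure \<Rightarrow> nat \<Rightarrow> ('w \<Rightarrow> real vec) \<Rightarrow> real vec" where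
  "std_dev_vec M n V = map_vec sqrt (diag_vec (covariance_mat M n V))"

definition unit_cube :: "nat \<Rightarrow> real vec set" where
  "unit_cube n = {x \<in> carrier_vec n. \<forall>k<n. 0 \<le> x $ k \<and> x $ k \<le> 1}"

record 'x min_problem =
  objective :: "'x \<Rightarrow> real"
  feasible_set :: "'x set"

(* minimize f x over x in X subject to g x *)
definition minimize :: "'x set \<Rightarrow> ('x \<Rightarrow> real) \<Rightarrow> ('x \<Rightarrow> bool) \<Rightarrow> 'x min_problem" where
  "minimize X f g = \<lparr>objective = f, feasible_set = {x \<in> X. g x}\<rparr>"

(* Blocks are indexed by 1..N, and by 0..N for the columns of design_mat. For i \<noteq> j, Cb i j is the
   block C_{i,j}; Db i 0 and Db i i are the blocks D_{i,0} and D_{i,i}. Other values of Cb and Db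
   are not used. *)
definition coupling_mat :: "nat \<Rightarrow> (nat \<Rightarrow> nat) \<Rightarrow> (nat \<Rightarrow> nat \<Rightarrow> real mat) \<Rightarrow> real mat" where
  "coupling_mat N p Cb = vcat_mat (\<Sum>i=1..N. p i)
     (map (\<lambda>i. hcat_mat (p i) (map (\<lambda>j. if i = j then 1\<^sub>m (p i) else - Cb i j) [1..<Suc N]))
       [1..<Suc N])"

definition design_mat :: "nat \<Rightarrow> (nat \<Rightarrow> nat) \<Rightarrow> (nat \<Rightarrow> nat \<Rightarrow> real mat) \<Rightarrow> real mat" where
  "design_mat N d Db = vcat_mat (d 0) (map (\<lambda>i. Db i 0) [1..<Suc N])
     @\<^sub>c diag_block_mat (map (\<lambda>i. Db i i) [1..<Suc N])"

end

theory Submission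
  imports Defs
begin

text \<open>
  The covariance matrix of \<open>w - P U\<close> is \<open>P Cov[U] P\<^sup>T\<close>, and \<open>Cov[U]\<close> is block diagonal because the
  components of two distinct blocks are independent, hence uncorrelated. As \<open>U\<close> is centered,
  \<open>A x - b - P U\<close> has expectation \<open>A x - b\<close>, so the two constraints coincide for every \<open>x\<close>.
\<close>

section \<open>Scalar covariance and covariance matrices\<close>

text \<open>Every entry of \<open>covariance_mat\<close> has this scalar form, so independence and
  symmetry can be used one pair of components at a time.\<close>

definition covariance :: "'w measure \<Rightarrow> ('w \<Rightarrow> real) \<Rightarrow> ('w \<Rightarrow> real) \<Rightarrow> real" where
  "covariance M X Y = (\<integral>\<omega>. (X \<omega> - (\<integral>\<omega>. X \<omega> \<partial>M)) * (Y \<omega> - (\<integral>\<omega>. Y \<omega> \<partial>M)) \<partial>M)"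

text \<open>Agreement is asked on \<open>space M\<close> only, because the dimensions of the random
  vectors, and with them the index rules, are known only there.\<close>

lemma covariance_cong:
  assumes "\<And>\<omega>. \<omega> \<in> space M \<Longrightarrow> X \<omega> = X' \<omega>" and "\<And>\<omega>. \<omega> \<in> space M \<Longrightarrow> Y \<omega> = Y' \<omega>"
  shows "covariance M X Y = covariance M X' Y'"
proof -
  have "(\<integral>\<omega>. X \<omega> \<partial>M) = (\<integral>\<omega>. X' \<omega> \<partial>M)" "(\<integral>\<omega>. Y \<omega> \<partial>M) = (\<integral>\<omega>. Y' \<omega> \<partial>M)"
    using assms by (auto intro: Bochner_Integration.integral_cong)
  then show ?thesis
    unfolding covariance_def using assms by (auto intro: Bochner_Integration.integral_cong)
qed

lemma covariance_commute: "covariance M X Y = covariance M Y X"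
  by (simp add: covariance_def mult.commute)

text \<open>Centering preserves independence, so the expectation of the product factors, and the
  factor coming from \<open>X\<close> has mean zero.\<close>

lemma (in prob_space) covariance_indep_var:
  assumes "indep_var borel X borel Y" "integrable M X" "integrable M Y"
  shows "covariance M X Y = 0"
proof -
  define mX mY where "mX = expectation X" and "mY = expectation Y"
  have "indep_var borel ((\<lambda>x. x - mX) \<circ> X) borel ((\<lambda>y. y - mY) \<circ> Y)"
    by (rule indep_var_compose[OF assms(1)]) auto
  then have ind: "indep_var borel (\<lambda>\<omega>. X \<omega> - mX) borel (\<lambda>\<omega>. Y \<omega> - mY)"
    by (simp add: o_def)
  have "expectation (\<lambda>\<omega>. X \<omega> - mX) = 0"
    using assms(2) by (simp add: mX_def prob_space)
  then show ?thesis
    using indep_var_lebesgue_integral[OF ind] assms(2,3)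
    by (simp add: covariance_def mX_def mY_def)
qed

lemma covariance_mat_alt:
  "covariance_mat M n V = mat n n (\<lambda>(k, l). covariance M (\<lambda>\<omega>. V \<omega> $ k) (\<lambda>\<omega>. V \<omega> $ l))"
  by (rule eq_matI) (simp_all add: covariance_mat_def covariance_def expectation_vec_def)

lemma covariance_mat_dim [simp]:
  "dim_row (covariance_mat M n V) = n" "dim_col (covariance_mat M n V) = n"
  by (simp_all add: covariance_mat_alt)

text \<open>Induction step for a list of blocks. The hypothesis covers the upper right block; the
  lower left one follows by symmetry of \<open>covariance\<close>.\<close>

lemma covariance_mat_append:
  assumes V: "\<And>\<omega>. \<omega> \<in> space M \<Longrightarrow> V \<omega> \<in> carrier_vec n"
    and W: "\<And>\<omega>. \<omega> \<in> space M \<Longrightarrow> W \<omega> \<in> carrier_vec m"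
    and uncorrelated: "\<And>k l. k < n \<Longrightarrow> l < m \<Longrightarrow> covariance M (\<lambda>\<omega>. V \<omega> $ k) (\<lambda>\<omega>. W \<omega> $ l) = 0"
  shows "covariance_mat M (n + m) (\<lambda>\<omega>. V \<omega> @\<^sub>v W \<omega>)
    = four_block_mat (covariance_mat M n V) (0\<^sub>m n m) (0\<^sub>m m n) (covariance_mat M m W)"
    (is "?L = ?R")
proof (rule eq_matI)
  fix k l assume kl: "k < dim_row ?R" "l < dim_col ?R"
  then have k: "k < n + m" and l: "l < n + m" by simp_all
  \<comment> \<open>\<open>Z j\<close> is entry \<open>j\<close> of the concatenation with the
    choice between \<open>V\<close> and \<open>W\<close> made outside the function of \<omega>, so
    that the four blocks become a case split on \<open>k\<close> and \<open>l\<close>.\<close>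
  define Z where "Z k = (if k < n then (\<lambda>\<omega>. V \<omega> $ k) else (\<lambda>\<omega>. W \<omega> $ (k - n)))" for k
  have "(V \<omega> @\<^sub>v W \<omega>) $ j = Z j \<omega>" if "j < n + m" "\<omega> \<in> space M" for j \<omega>
    using that carrier_vecD[OF V[of \<omega>]] carrier_vecD[OF W[of \<omega>]] by (simp add: Z_def)
  then have "covariance M (\<lambda>\<omega>. (V \<omega> @\<^sub>v W \<omega>) $ k) (\<lambda>\<omega>. (V \<omega> @\<^sub>v W \<omega>) $ l) = covariance M (Z k) (Z l)"
    using k l by (intro covariance_cong) auto
  moreover have "covariance M (Z k) (Z l) = ?R $$ (k, l)"
    using k l uncorrelated[of k "l - n"]
      uncorrelated[of l "k - n", unfolded covariance_commute[of M "\<lambda>\<omega>. V \<omega> $ l"]]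
    by (auto simp: Z_def covariance_mat_alt)
  ultimately show "?L $$ (k, l) = ?R $$ (k, l)"
    using k l by (simp add: covariance_mat_alt)
qed simp_all

section \<open>Concatenated block vectors\<close>

lemma vcat_vec_simps [simp]:
  "vcat_vec [] = 0\<^sub>v 0" "vcat_vec (v # vs) = v @\<^sub>v vcat_vec vs"
  by (simp_all add: vcat_vec_def)

lemma vcat_vec_map_carrier:
  "(\<And>i. i \<in> set is \<Longrightarrow> v i \<in> carrier_vec (p i)) \<Longrightarrow>
    vcat_vec (map v is) \<in> carrier_vec (sum_list (map p is))"
  by (induction "is") auto

text \<open>The order of the quantifiers is the point: \<open>i\<close> and \<open>r\<close> depend
  on \<open>k\<close> and the block sizes but not on \<open>v\<close>, so one pair serves all
  outcomes \<omega> at once.\<close>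

lemma vcat_vec_index_block:
  fixes p :: "'i \<Rightarrow> nat"
  assumes "k < sum_list (map p is)"
  shows "\<exists>i \<in> set is. \<exists>r < p i. \<forall>v :: 'i \<Rightarrow> 'a :: zero vec. (\<forall>i \<in> set is. v i \<in> carrier_vec (p i)) \<longrightarrow>
    vcat_vec (map v is) $ k = v i $ r"
  using assms
proof (induction "is" arbitrary: k)
  case (Cons j js)
  have dim: "dim_vec (vcat_vec (map v js)) = sum_list (map p js)"
    if "\<forall>i \<in> set (j # js). v i \<in> carrier_vec (p i)" for v :: "'i \<Rightarrow> 'a vec"
    using that by (intro carrier_vecD vcat_vec_map_carrier) auto
  show ?case
  proof (cases "k < p j")
    case True
    then show ?thesis
      using dim by (intro bexI[of _ j] exI[of _ k]) auto
  next
    case False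
    with Cons.prems have "k - p j < sum_list (map p js)" by auto
    from Cons.IH[OF this] obtain i r where ir: "i \<in> set js" "r < p i"
      and eq: "\<forall>v :: 'i \<Rightarrow> 'a vec. (\<forall>i \<in> set js. v i \<in> carrier_vec (p i)) \<longrightarrow> vcat_vec (map v js) $ (k - p j) = v i $ r"
      by blast
    have "vcat_vec (map v (j # js)) $ k = v i $ r"
      if v: "\<forall>i \<in> set (j # js). v i \<in> carrier_vec (p i)" for v :: "'i \<Rightarrow> 'a vec"
      using dim[OF v] v False Cons.prems eq by (auto simp: carrier_vecD)
    with ir show ?thesis by (intro bexI[of _ i] exI[of _ r]) auto
  qed
qed simp

text \<open>The opposite direction, again uniform in \<open>v\<close>. It serves to carry
  integrability from the concatenated vector to the entries of its blocks.\<close>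

lemma block_index_vcat_vec:
  fixes p :: "'i \<Rightarrow> nat"
  assumes "i \<in> set is" "r < p i"
  shows "\<exists>k < sum_list (map p is). \<forall>v :: 'i \<Rightarrow> 'a :: zero vec. (\<forall>i \<in> set is. v i \<in> carrier_vec (p i)) \<longrightarrow>
    vcat_vec (map v is) $ k = v i $ r"
  using assms
proof (induction "is")
  case (Cons j js)
  have dim: "dim_vec (vcat_vec (map v js)) = sum_list (map p js)"
    if "\<forall>i \<in> set (j # js). v i \<in> carrier_vec (p i)" for v :: "'i \<Rightarrow> 'a vec"
    using that by (intro carrier_vecD vcat_vec_map_carrier) auto
  show ?case
  proof (cases "i = j")
    case True
    then show ?thesis
      using dim Cons.prems by (intro exI[of _ r]) auto
  next
    case False
    with Cons obtain k where k: "k < sum_list (map p js)"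
      and eq: "\<forall>v :: 'i \<Rightarrow> 'a vec. (\<forall>i \<in> set js. v i \<in> carrier_vec (p i)) \<longrightarrow> vcat_vec (map v js) $ k = v i $ r"
      by auto
    have "vcat_vec (map v (j # js)) $ (p j + k) = v i $ r"
      if v: "\<forall>i \<in> set (j # js). v i \<in> carrier_vec (p i)" for v :: "'i \<Rightarrow> 'a vec"
      using dim[OF v] v k eq by (auto simp: carrier_vecD)
    with k show ?thesis by (intro exI[of _ "p j + k"]) auto
  qed
qed simp

text \<open>Induction on the list: each entry of the tail of the vector is an entry of some later
  block, which differs from the first by distinctness, so head and tail are uncorrelated and
  \<open>covariance_mat_append\<close> applies.\<close>

lemma covariance_mat_vcat:
  assumes "distinct is"
    and "\<And>i \<omega>. i \<in> set is \<Longrightarrow> \<omega> \<in> space M \<Longrightarrow> V i \<omega> \<in> carrier_vec (p i)"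
    and "\<And>i j r s. i \<in> set is \<Longrightarrow> j \<in> set is \<Longrightarrow> i \<noteq> j \<Longrightarrow> r < p i \<Longrightarrow> s < p j \<Longrightarrow>
      covariance M (\<lambda>\<omega>. V i \<omega> $ r) (\<lambda>\<omega>. V j \<omega> $ s) = 0"
  shows "covariance_mat M (sum_list (map p is)) (\<lambda>\<omega>. vcat_vec (map (\<lambda>i. V i \<omega>) is))
    = diag_block_mat (map (\<lambda>i. covariance_mat M (p i) (V i)) is)"
  using assms
proof (induction "is")
  case Nil
  show ?case by (rule eq_matI) auto
next
  case (Cons j js)
  have IH: "covariance_mat M (sum_list (map p js)) (\<lambda>\<omega>. vcat_vec (map (\<lambda>i. V i \<omega>) js))
    = diag_block_mat (map (\<lambda>i. covariance_mat M (p i) (V i)) js)"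
    using Cons.prems by (intro Cons.IH) auto
  have "covariance M (\<lambda>\<omega>. V j \<omega> $ r) (\<lambda>\<omega>. vcat_vec (map (\<lambda>i. V i \<omega>) js) $ l) = 0"
    if r: "r < p j" and l: "l < sum_list (map p js)" for r l
  proof -
    from vcat_vec_index_block[OF l] obtain i s where i: "i \<in> set js" "s < p i"
      and eq: "\<And>v :: _ \<Rightarrow> real vec. (\<forall>i \<in> set js. v i \<in> carrier_vec (p i)) \<Longrightarrow>
        vcat_vec (map v js) $ l = v i $ s"
      by blast
    have "covariance M (\<lambda>\<omega>. V j \<omega> $ r) (\<lambda>\<omega>. vcat_vec (map (\<lambda>i. V i \<omega>) js) $ l)
      = covariance M (\<lambda>\<omega>. V j \<omega> $ r) (\<lambda>\<omega>. V i \<omega> $ s)"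
      using Cons.prems(2) by (intro covariance_cong eq) auto
    also have "\<dots> = 0"
      using Cons.prems(1) i r by (intro Cons.prems(3)) auto
    finally show ?thesis .
  qed
  then have "covariance_mat M (p j + sum_list (map p js)) (\<lambda>\<omega>. V j \<omega> @\<^sub>v vcat_vec (map (\<lambda>i. V i \<omega>) js))
    = four_block_mat (covariance_mat M (p j) (V j)) (0\<^sub>m (p j) (sum_list (map p js)))
        (0\<^sub>m (sum_list (map p js)) (p j))
        (covariance_mat M (sum_list (map p js)) (\<lambda>\<omega>. vcat_vec (map (\<lambda>i. V i \<omega>) js)))"
    using Cons.prems(2) by (intro covariance_mat_append vcat_vec_map_carrier) auto
  then show ?case
    unfolding IH by (simp add: Let_def dim_diag_block_mat o_def)
qed

section \<open>Measurability and integrability of components\<close>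

lemma space_borel_vec [simp]: "space (borel_vec n) = carrier_vec n"
  by (simp add: borel_vec_def)

text \<open>Reading off an entry is the map that generates \<open>borel_vec\<close> followed by a
  coordinate projection of the product space.\<close>

lemma measurable_borel_vec_index:
  assumes "k < n"
  shows "(\<lambda>v. v $ k) \<in> borel_measurable (borel_vec n)"
proof -
  have "(\<lambda>v. \<lambda>k\<in>{..<n}. v $ k) \<in> measurable (borel_vec n) (\<Pi>\<^sub>M k\<in>{..<n}. borel :: real measure)"
    unfolding borel_vec_def by (rule measurable_vimage_algebra1) (auto simp: space_PiM)
  from measurable_compose[OF this measurable_component_singleton[of k]] assms
  show ?thesis by simp
qed

lemma square_integrable_vec_carrier:
  "square_integrable_vec M n V \<Longrightarrow> \<omega> \<in> space M \<Longrightarrow> V \<omega> \<in> carrier_vec n"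
  by (auto simp: square_integrable_vec_def dest: measurable_space)

lemma square_integrable_vec_measurable:
  "square_integrable_vec M n V \<Longrightarrow> k < n \<Longrightarrow> (\<lambda>\<omega>. V \<omega> $ k) \<in> borel_measurable M"
  unfolding square_integrable_vec_def
  by (blast intro: measurable_compose[OF _ measurable_borel_vec_index])

lemma (in prob_space) square_integrable_vec_integrable:
  assumes "square_integrable_vec M n V" "k < n"
  shows "integrable M (\<lambda>\<omega>. V \<omega> $ k)"
  using assms square_integrable_vec_measurable[OF assms]
  by (auto simp: square_integrable_vec_def intro: square_integrable_imp_integrable)

text \<open>By domination: 2 |x y| is at most x^2 + y^2, hence so is |x y|, and the sum of the two
  squares is integrable.\<close>

lemma integrable_mult_square_integrable:
  fixes f g :: "'w \<Rightarrow> real"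
  assumes [measurable]: "f \<in> borel_measurable M" "g \<in> borel_measurable M"
    and "integrable M (\<lambda>\<omega>. (f \<omega>)\<^sup>2)" "integrable M (\<lambda>\<omega>. (g \<omega>)\<^sup>2)"
  shows "integrable M (\<lambda>\<omega>. f \<omega> * g \<omega>)"
proof (rule Bochner_Integration.integrable_bound)
  show "integrable M (\<lambda>\<omega>. (f \<omega>)\<^sup>2 + (g \<omega>)\<^sup>2)"
    using assms by simp
  have "\<bar>x * y\<bar> \<le> x\<^sup>2 + y\<^sup>2" for x y :: real
  proof -
    have "2 * \<bar>x * y\<bar> \<le> x\<^sup>2 + y\<^sup>2"
      using sum_squares_bound[of "\<bar>x\<bar>" "\<bar>y\<bar>"] by (simp add: abs_mult)
    then show ?thesis using abs_ge_zero[of "x * y"] by linarith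
  qed
  then show "AE \<omega> in M. norm (f \<omega> * g \<omega>) \<le> norm ((f \<omega>)\<^sup>2 + (g \<omega>)\<^sup>2)"
    by (intro AE_I2) simp
qed simp

text \<open>Expanding the square of \<open>V \<omega> $ j - w\<close> leaves a square, a linear term
  and a constant, each integrable on a probability space; the product is then covered by
  \<open>integrable_mult_square_integrable\<close>.\<close>

lemma (in prob_space) integrable_centered_product:
  assumes V: "square_integrable_vec M n V" and k: "k < n" and l: "l < n"
  shows "integrable M (\<lambda>\<omega>. (V \<omega> $ k - u) * (V \<omega> $ l - v))"
proof -
  note square_integrable_vec_measurable[OF V k, measurable]
    square_integrable_vec_measurable[OF V l, measurable]
  have "integrable M (\<lambda>\<omega>. (V \<omega> $ j - w)\<^sup>2)" if "j < n" for j w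
  proof -
    have "integrable M (\<lambda>\<omega>. (V \<omega> $ j)\<^sup>2 - 2 * w * V \<omega> $ j + w\<^sup>2)"
      using V that square_integrable_vec_integrable[OF V that]
      by (simp add: square_integrable_vec_def)
    then show ?thesis by (simp add: power2_diff algebra_simps)
  qed
  then show ?thesis
    using k l by (intro integrable_mult_square_integrable) auto
qed

section \<open>Moments of affine images\<close>

lemma mult_mat_vec_index:
  assumes "B \<in> carrier_mat m n" "v \<in> carrier_vec n" "k < m"
  shows "(B *\<^sub>v v) $ k = (\<Sum>j<n. B $$ (k, j) * v $ j)"
  using assms by (auto simp: scalar_prod_def atLeast0LessThan intro!: sum.cong)

lemma (in prob_space) expectation_vec_affine:
  assumes V: "square_integrable_vec M n V"
    and B: "B \<in> carrier_mat m n" and w: "w \<in> carrier_vec m"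
  shows "expectation_vec M m (\<lambda>\<omega>. w - B *\<^sub>v V \<omega>) = w - B *\<^sub>v expectation_vec M n V"
proof (rule eq_vecI)
  fix k assume "k < dim_vec (w - B *\<^sub>v expectation_vec M n V)"
  then have k: "k < m" using B by simp
  have "expectation (\<lambda>\<omega>. (w - B *\<^sub>v V \<omega>) $ k)
    = expectation (\<lambda>\<omega>. w $ k - (\<Sum>j<n. B $$ (k, j) * V \<omega> $ j))"
    using k B w mult_mat_vec_index[OF B square_integrable_vec_carrier[OF V]]
    \<comment> \<open>The default rule would turn the product into a scalar product with a row; it
      is removed so that the explicit sum from \<open>mult_mat_vec_index\<close> is used.\<close>
    by (intro Bochner_Integration.integral_cong) (simp_all del: index_mult_mat_vec)
  also have "\<dots> = w $ k - (\<Sum>j<n. B $$ (k, j) * expectation (\<lambda>\<omega>. V \<omega> $ j))"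
  proof -
    have int: "integrable M (\<lambda>\<omega>. B $$ (k, j) * V \<omega> $ j)" if "j \<in> {..<n}" for j
      using square_integrable_vec_integrable[OF V] that by simp
    have "integrable M (\<lambda>\<omega>. \<Sum>j<n. B $$ (k, j) * V \<omega> $ j)"
      by (intro Bochner_Integration.integrable_sum int)
    then show ?thesis
      by (simp add: prob_space) (subst Bochner_Integration.integral_sum[OF int]; simp)
  qed
  finally show "expectation_vec M m (\<lambda>\<omega>. w - B *\<^sub>v V \<omega>) $ k = (w - B *\<^sub>v expectation_vec M n V) $ k"
    using k B w by (simp add: expectation_vec_def scalar_prod_def atLeast0LessThan)
qed (use B in \<open>simp add: expectation_vec_def\<close>)

text \<open>Centering cancels the shift \<open>w\<close>, and the minus sign occurs twice in each
  product. What remains is bilinear in the centered components, whose products are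
  integrable.\<close>

lemma (in prob_space) covariance_mat_affine:
  assumes V: "square_integrable_vec M n V"
    and B: "B \<in> carrier_mat m n" and w: "w \<in> carrier_vec m"
  shows "covariance_mat M m (\<lambda>\<omega>. w - B *\<^sub>v V \<omega>) = B * covariance_mat M n V * B\<^sup>T"
    (is "?L = ?R")
proof (rule eq_matI)
  fix k l assume "k < dim_row ?R" "l < dim_col ?R"
  then have k: "k < m" and l: "l < m" using B by simp_all
  define X where "X j \<omega> = V \<omega> $ j - expectation (\<lambda>\<omega>. V \<omega> $ j)" for j \<omega>
  have centered: "(w - B *\<^sub>v V \<omega>) $ i - expectation_vec M m (\<lambda>\<omega>. w - B *\<^sub>v V \<omega>) $ i
      = - (\<Sum>j<n. B $$ (i, j) * X j \<omega>)" if "i < m" "\<omega> \<in> space M" for i \<omega>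
    unfolding expectation_vec_affine[OF assms]
    using that B w mult_mat_vec_index[OF B square_integrable_vec_carrier[OF V]]
      mult_mat_vec_index[OF B, of "expectation_vec M n V"]
    by (simp add: X_def expectation_vec_def sum_subtractf right_diff_distrib
        del: index_mult_mat_vec)
  have "?L $$ (k, l)
    = expectation (\<lambda>\<omega>. (\<Sum>i<n. B $$ (k, i) * X i \<omega>) * (\<Sum>j<n. B $$ (l, j) * X j \<omega>))"
    using k l centered by (auto simp: covariance_mat_def intro: Bochner_Integration.integral_cong)
  \<comment> \<open>The sum over \<open>j\<close> is put outermost to match the entries of
    \<open>B * covariance_mat M n V * B\<^sup>T\<close>, which associates to the left.\<close>
  also have "\<dots> = expectation (\<lambda>\<omega>. \<Sum>j<n. \<Sum>i<n. B $$ (k, i) * B $$ (l, j) * (X i \<omega> * X j \<omega>))"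
    by (subst sum.swap) (simp add: sum_product mult_ac)
  also have "\<dots> = (\<Sum>j<n. \<Sum>i<n. B $$ (k, i) * B $$ (l, j) * expectation (\<lambda>\<omega>. X i \<omega> * X j \<omega>))"
  proof -
    have int: "integrable M (\<lambda>\<omega>. B $$ (k, i) * B $$ (l, j) * (X i \<omega> * X j \<omega>))"
      if "j \<in> {..<n}" "i \<in> {..<n}" for i j
      using integrable_centered_product[OF V] that by (simp add: X_def)
    have "expectation (\<lambda>\<omega>. \<Sum>i<n. B $$ (k, i) * B $$ (l, j) * (X i \<omega> * X j \<omega>))
      = (\<Sum>i<n. B $$ (k, i) * B $$ (l, j) * expectation (\<lambda>\<omega>. X i \<omega> * X j \<omega>))"
      if "j \<in> {..<n}" for j
      by (subst Bochner_Integration.integral_sum[OF int[OF that]]) simp_all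
    then show ?thesis
      by (subst Bochner_Integration.integral_sum)
        (auto intro!: Bochner_Integration.integrable_sum int sum.cong)
  qed
  also have "\<dots> = ?R $$ (k, l)"
    using k l B
    by (simp add: X_def covariance_mat_def expectation_vec_def scalar_prod_def atLeast0LessThan
        sum_distrib_left sum_distrib_right mult_ac)
  finally show "?L $$ (k, l) = ?R $$ (k, l)" .
qed (use B in simp_all)

section \<open>Covariance of independent blocks\<close>

text \<open>Independence makes entries of distinct blocks uncorrelated once they are integrable. As
  square integrability is given for the concatenation, integrability of a block entry is obtained by
  locating it there.\<close>

lemma (in prob_space) covariance_mat_vcat_indep:
  assumes "distinct is" and indep: "indep_vars (\<lambda>i. borel_vec (p i)) V (set is)"
    and sq: "square_integrable_vec M (sum_list (map p is)) (\<lambda>\<omega>. vcat_vec (map (\<lambda>i. V i \<omega>) is))"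
  shows "covariance_mat M (sum_list (map p is)) (\<lambda>\<omega>. vcat_vec (map (\<lambda>i. V i \<omega>) is))
    = diag_block_mat (map (\<lambda>i. covariance_mat M (p i) (V i)) is)"
proof (rule covariance_mat_vcat)
  show V: "V i \<omega> \<in> carrier_vec (p i)" if "i \<in> set is" "\<omega> \<in> space M" for i \<omega>
    using indep that by (auto simp: indep_vars_def dest!: bspec[of _ _ i] measurable_space)
  have int: "integrable M (\<lambda>\<omega>. V i \<omega> $ r)" if ir: "i \<in> set is" "r < p i" for i r
  proof -
    from block_index_vcat_vec[of i "is" r p, OF ir] obtain k where k: "k < sum_list (map p is)"
      and eq: "\<And>v :: _ \<Rightarrow> real vec. (\<forall>i \<in> set is. v i \<in> carrier_vec (p i)) \<Longrightarrow>
        vcat_vec (map v is) $ k = v i $ r"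
      by blast
    have "integrable M (\<lambda>\<omega>. vcat_vec (map (\<lambda>i. V i \<omega>) is) $ k)"
      by (rule square_integrable_vec_integrable[OF sq k])
    also have "?this \<longleftrightarrow> ?thesis"
      using V by (intro Bochner_Integration.integrable_cong eq) auto
    finally show ?thesis .
  qed
  fix i j r s assume ij: "i \<in> set is" "j \<in> set is" "i \<noteq> j" and rs: "r < p i" "s < p j"
  \<comment> \<open>Restricting the family to the disjoint index sets \<open>{i}\<close> and
    \<open>{j}\<close> gives a pair of independent functions; evaluating them at their index and
    taking an entry yields independent real variables.\<close>
  have "indep_var (PiM {i} (\<lambda>i. borel_vec (p i))) (\<lambda>\<omega>. \<lambda>h\<in>{i}. V h \<omega>)
      (PiM {j} (\<lambda>i. borel_vec (p i))) (\<lambda>\<omega>. \<lambda>h\<in>{j}. V h \<omega>)"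
    using ij by (intro indep_var_restrict[OF indep]) auto
  moreover have "(\<lambda>f. f h $ q) \<in> borel_measurable (PiM {h} (\<lambda>i. borel_vec (p i)))"
    if "q < p h" for h q
    using that
    by (intro measurable_compose[OF measurable_component_singleton[of h "{h}"] measurable_borel_vec_index]) auto
  ultimately have "indep_var borel ((\<lambda>f. f i $ r) \<circ> (\<lambda>\<omega>. \<lambda>h\<in>{i}. V h \<omega>))
      borel ((\<lambda>f. f j $ s) \<circ> (\<lambda>\<omega>. \<lambda>h\<in>{j}. V h \<omega>))"
    using rs by (intro indep_var_compose) auto
  then show "covariance M (\<lambda>\<omega>. V i \<omega> $ r) (\<lambda>\<omega>. V j \<omega> $ s) = 0"
    using int ij rs by (intro covariance_indep_var) (simp_all add: o_def)
qed fact

section \<open>Inverse and size of the coupling matrix\<close>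

text \<open>An invertible matrix is a unit of the matrix ring, which rules out the result
  \<open>None\<close>. Squareness comes from \<open>invertible_mat\<close>, so a bound on the number
  of rows alone determines the size.\<close>

lemma mat_inverse_carrier:
  fixes B :: "'a :: field mat"
  assumes B: "B \<in> carrier_mat n m" and inv: "invertible_mat B"
  shows "the (mat_inverse B) \<in> carrier_mat n n"
proof -
  from inv B have [simp]: "m = n" by (simp add: invertible_mat_def)
  from inv obtain B' where B': "B * B' = 1\<^sub>m (dim_row B)" "B' * B = 1\<^sub>m (dim_row B')"
    by (auto simp: invertible_mat_def inverts_mat_def)
  \<comment> \<open>The two product identities do not state the size of \<open>B'\<close>; comparing
    their column counts gives it.\<close>
  from arg_cong[OF B'(1), of dim_col] arg_cong[OF B'(2), of dim_col] B
  have "B' \<in> carrier_mat n n" by auto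
  with B B' have "B \<in> Units (ring_mat TYPE('a) n ())"
    by (auto simp: Units_def ring_mat_simps)
  with mat_inverse(1)[of B n "()"] B obtain B'' where "mat_inverse B = Some B''"
    by auto
  with mat_inverse(2)[of B n] B show ?thesis by simp
qed

lemma dim_row_vcat_mat: "dim_row (vcat_mat n As) = sum_list (map dim_row As)"
  by (induction As) (auto simp: vcat_mat_def append_rows_def)

lemma dim_row_hcat_mat:
  "(\<And>A. A \<in> set As \<Longrightarrow> dim_row A = n) \<Longrightarrow> As \<noteq> [] \<Longrightarrow> dim_row (hcat_mat n As) = n"
  by (cases As) (auto simp: hcat_mat_def append_cols_def)

text \<open>This fixes the size of the inverse \<open>P\<close>. Row block \<open>i\<close> has
  height \<open>p i\<close> because its identity block and its negated blocks \<open>Cb i j\<close>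
  all do.\<close>

lemma dim_row_coupling_mat:
  assumes "\<And>i j. i \<in> {1..N} \<Longrightarrow> j \<in> {1..N} \<Longrightarrow> i \<noteq> j \<Longrightarrow> Cb i j \<in> carrier_mat (p i) (p j)"
  shows "dim_row (coupling_mat N p Cb) = (\<Sum>i=1..N. p i)"
proof -
  have "dim_row (hcat_mat (p i) (map (\<lambda>j. if i = j then 1\<^sub>m (p i) else - Cb i j) [1..<Suc N])) = p i"
    if "i \<in> {1..N}" for i
    using that assms[of i, THEN carrier_matD(1)] by (intro dim_row_hcat_mat) auto
  then have "dim_row (coupling_mat N p Cb) = sum_list (map p [1..<Suc N])"
    unfolding coupling_mat_def dim_row_vcat_mat map_map
    by (intro arg_cong[of _ _ sum_list] map_cong) (auto simp del: upt_Suc)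
  then show ?thesis
    by (simp add: interv_sum_list_conv_sum_set_nat atLeastLessThanSuc_atLeastAtMost del: upt_Suc)
qed

section \<open>Equivalence of the robust and the deterministic constraint\<close>

theorem proposition3:
  fixes N dim_x dim_y :: nat and d p :: "nat \<Rightarrow> nat"
    and a t \<alpha> c b :: "real vec"
    and Cb Db :: "nat \<Rightarrow> nat \<Rightarrow> real mat"
    and C D P \<beta> Qx0 Q A \<Sigma> :: "real mat"
    and d0 \<kappa> :: real
    and M :: "'w measure"
    and Us :: "nat \<Rightarrow> 'w \<Rightarrow> real vec" and U :: "'w \<Rightarrow> real vec"
    and \<Sigma>s :: "nat \<Rightarrow> real mat"
  assumes "N \<ge> 1"
    and "\<And>i. i \<le> N \<Longrightarrow> d i \<ge> 1"
    and "\<And>i. i \<in> {1..N} \<Longrightarrow> p i \<ge> 1"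
    and "dim_x = (\<Sum>i=0..N. d i)"
    and "dim_y = (\<Sum>i=1..N. p i)"
    and "a \<in> carrier_vec dim_y"
    and "t \<in> carrier_vec dim_y"
    and "\<And>i. i \<in> {1..N} \<Longrightarrow> Db i 0 \<in> carrier_mat (p i) (d 0)"
    and "\<And>i. i \<in> {1..N} \<Longrightarrow> Db i i \<in> carrier_mat (p i) (d i)"
    and "\<And>i j. i \<in> {1..N} \<Longrightarrow> j \<in> {1..N} \<Longrightarrow> i \<noteq> j \<Longrightarrow> Cb i j \<in> carrier_mat (p i) (p j)"
    and "D = design_mat N d Db"
    and "C = coupling_mat N p Cb"
    and "invertible_mat C"
    and "P = the (mat_inverse C)"
    and "\<alpha> = P *\<^sub>v a"
    and "\<beta> = - (P * D)"
    and "Qx0 = diag_block_mat [1\<^sub>m (d 0), 0\<^sub>m (dim_x - d 0) (dim_x - d 0)]"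
    and "Q = 2 \<cdot>\<^sub>m (Qx0 + \<beta>\<^sup>T * \<beta>)"
    and "c = 2 \<cdot>\<^sub>v (\<beta>\<^sup>T *\<^sub>v \<alpha>)"
    and "d0 = \<alpha> \<bullet> \<alpha>"
    and "A = - \<beta>"
    and "b = \<alpha> - t"
    and "prob_space M"
    and "U = (\<lambda>\<omega>. vcat_vec (map (\<lambda>i. Us i \<omega>) [1..<Suc N]))"
    and "prob_space.indep_vars M (\<lambda>i. borel_vec (p i)) Us {1..N}"
    and "square_integrable_vec M dim_y U"
    and "expectation_vec M dim_y U = 0\<^sub>v dim_y"
    and "\<And>i. i \<in> {1..N} \<Longrightarrow> covariance_mat M (p i) (Us i) = \<Sigma>s i"
    and "\<Sigma> = diag_block_mat (map \<Sigma>s [1..<Suc N])"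
  shows "minimize (unit_cube dim_x)
           (\<lambda>x. 1 / 2 * (x \<bullet> (Q *\<^sub>v x)) + c \<bullet> x + d0
                 + (\<integral>\<omega>. U \<omega> \<bullet> (P\<^sup>T * P *\<^sub>v U \<omega>) \<partial>M))
           (\<lambda>x. expectation_vec M dim_y (\<lambda>\<omega>. A *\<^sub>v x - b - P *\<^sub>v U \<omega>)
                 + \<kappa> \<cdot>\<^sub>v std_dev_vec M dim_y (\<lambda>\<omega>. A *\<^sub>v x - b - P *\<^sub>v U \<omega>) \<le> 0\<^sub>v dim_y)
       = minimize (unit_cube dim_x)
           (\<lambda>x. 1 / 2 * (x \<bullet> (Q *\<^sub>v x)) + c \<bullet> x + d0
                 + (\<integral>\<omega>. U \<omega> \<bullet> (P\<^sup>T * P *\<^sub>v U \<omega>) \<partial>M))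
           (\<lambda>x. A *\<^sub>v x \<le> b - \<kappa> \<cdot>\<^sub>v map_vec sqrt (diag_vec (P * \<Sigma> * P\<^sup>T)))"
proof -
  interpret prob_space M by fact
  let ?is = "[1..<Suc N]"
  have is_set: "set ?is = {1..N}" by auto
  have dim_y: "dim_y = sum_list (map p ?is)"
    using assms(5)
    by (simp add: interv_sum_list_conv_sum_set_nat atLeastLessThanSuc_atLeastAtMost del: upt_Suc)
  \<comment> \<open>The column count is left open here; \<open>mat_inverse_carrier\<close> obtains
    it from invertibility.\<close>
  have "C \<in> carrier_mat dim_y (dim_col C)"
    using dim_row_coupling_mat[of N Cb p] assms(5,10,12) by (intro carrier_matI) auto
  then have P: "P \<in> carrier_mat dim_y dim_y"
    using mat_inverse_carrier assms(13,14) by blast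
  have b: "b \<in> carrier_vec dim_y" using assms(7,22) by (intro carrier_vecI) simp
  have A: "dim_row A = dim_y" using P assms(16,21) by simp
  have P0: "P *\<^sub>v 0\<^sub>v dim_y = 0\<^sub>v dim_y" using P by auto
  have U: "square_integrable_vec M dim_y U" by fact
  have "covariance_mat M dim_y U = diag_block_mat (map (\<lambda>i. covariance_mat M (p i) (Us i)) ?is)"
    unfolding dim_y assms(24)
    using assms(24-26) unfolding dim_y is_set[symmetric] by (intro covariance_mat_vcat_indep) auto
  also have "\<dots> = \<Sigma>"
    unfolding assms(29) using assms(28) is_set by (intro arg_cong[of _ _ diag_block_mat] map_cong) auto
  finally have cov: "covariance_mat M dim_y U = \<Sigma>" .
  have "expectation_vec M dim_y (\<lambda>\<omega>. A *\<^sub>v x - b - P *\<^sub>v U \<omega>)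
        + \<kappa> \<cdot>\<^sub>v std_dev_vec M dim_y (\<lambda>\<omega>. A *\<^sub>v x - b - P *\<^sub>v U \<omega>) \<le> 0\<^sub>v dim_y
      \<longleftrightarrow> A *\<^sub>v x \<le> b - \<kappa> \<cdot>\<^sub>v map_vec sqrt (diag_vec (P * \<Sigma> * P\<^sup>T))" for x
  proof -
    have w: "A *\<^sub>v x - b \<in> carrier_vec dim_y" using A b by (intro carrier_vecI) simp
    have E: "expectation_vec M dim_y (\<lambda>\<omega>. A *\<^sub>v x - b - P *\<^sub>v U \<omega>) = A *\<^sub>v x - b"
      unfolding expectation_vec_affine[OF U P w] assms(27)
      unfolding P0 using A b by (intro eq_vecI) auto
    define s where "s = map_vec sqrt (diag_vec (P * \<Sigma> * P\<^sup>T))"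
    have sd: "std_dev_vec M dim_y (\<lambda>\<omega>. A *\<^sub>v x - b - P *\<^sub>v U \<omega>) = s"
      unfolding std_dev_vec_def covariance_mat_affine[OF U P w] cov s_def ..
    have s: "dim_vec s = dim_y" using P by (simp add: s_def diag_vec_def diag_mat_def)
    show ?thesis
      \<comment> \<open>In each entry the two inequalities differ only by moving terms across;
        nothing is multiplied or divided by \<kappa>, so its sign does not matter.\<close>
      unfolding E sd s_def[symmetric] using s A b
      by (auto simp: less_eq_vec_def algebra_simps)
  qed
  \<comment> \<open>The objectives coincide literally, so rewriting the constraint equates the two
    problems.\<close>
  then show ?thesis by simp
qed

end
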